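(* Let $n\ge 1$, let $K=\mathbb{R}^n\subset\mathbb{C}^n$, and let $Q:K\to\mathbb{R}$ be $Q(x)=\frac12\log(1+x^2)$, i.e. $Q=-\log w$ for the weight $w(z)=\left|\frac{1}{(1+z^2)^{1/2}}\right|$ restricted to $K$. Then the weighted extremal function of $K$ with respect to $Q$ is $$V_{K,Q}(z)=\frac{1}{2}\log\Bigl([1+|z|^2]+\bigl\{[1+|z|^2]^2-|1+z^2|^2\bigr\}^{1/2}\Bigr),\qquad z\in\mathbb{C}^n.$$
   Context: For $z=(z_1,\dots,z_n)\in\mathbb{C}^n$ write $z^2:=z_1^2+\cdots+z_n^2$ and $|z|^2:=|z_1|^2+\cdots+|z_n|^2$. For a closed set $K\subset\mathbb{C}^n$ and a potential $Q=-\log w$ on $K$ (where $w:K\to[0,\infty)$ is upper semicontinuous with $\{z \in K: w(z)=0\}$ pluripolar), the weighted extremal function is $$V_{K,Q}(z):=\sup\Bigl\{\tfrac{1}{\deg(p)}\log|p(z)|:\ p\text{ a nonconstant holomorphic polynomial on }\mathbb{C}^n,\ \|pe^{-\deg(p)Q}\|_K\le 1\Bigr\},$$ where $\|g\|_K:=\sup_{K}|g|$. *)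

theory Defs
  imports "HOL-Analysis.Analysis" "HOL-Library.Poly_Mapping"
begin

text \<open>Logarithm of a non-negative real with \<open>log 0 = -\<infinity>\<close> (the library has \<open>ln 0 = 0\<close> on the reals).\<close>

definition log_ext :: "real \<Rightarrow> ereal" where
  "log_ext t = (if t = 0 then - \<infinity> else ereal (ln t))"

text \<open>Exponential on the extended reals: potentials \<open>Q = - log w\<close> take the value \<open>\<infinity>\<close> where
  the weight vanishes.\<close>

definition exp_ext :: "ereal \<Rightarrow> ereal" where
  "exp_ext q = (if q = \<infinity> then \<infinity> else if q = - \<infinity> then 0 else ereal (exp (real_of_ereal q)))"

text \<open>Polynomials in the coordinates of \<open>\<complex>\<^sup>n\<close> are finitely supported families of coefficients indexed
  by exponent vectors.\<close>

type_synonym 'n cpoly = "('n \<Rightarrow>\<^sub>0 nat) \<Rightarrow>\<^sub>0 complex"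

definition poly_eval :: "'n::finite cpoly \<Rightarrow> complex ^ 'n \<Rightarrow> complex" where
  "poly_eval p z =
     (\<Sum>m\<in>Poly_Mapping.keys p. Poly_Mapping.lookup p m * (\<Prod>i\<in>UNIV. (z $ i) ^ Poly_Mapping.lookup m i))"

text \<open>Total degree; the zero polynomial gets degree \<open>0\<close>, so a polynomial is nonconstant iff its
  degree is positive.\<close>

definition total_deg :: "'n::finite cpoly \<Rightarrow> nat" where
  "total_deg p =
     Max (insert 0 ((\<lambda>m. \<Sum>i\<in>UNIV. Poly_Mapping.lookup m i) ` Poly_Mapping.keys p))"

text \<open>The weighted sup norm \<open>\<parallel>p e\<^sup>-\<^sup>d\<^sup>Q\<parallel>\<^sub>K\<close> with \<open>d = deg p\<close>; it may be infinite.\<close>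

definition weighted_norm ::
    "(complex ^ 'n) set \<Rightarrow> (complex ^ 'n \<Rightarrow> ereal) \<Rightarrow> 'n::finite cpoly \<Rightarrow> ereal" where
  "weighted_norm K Q p =
     (SUP z\<in>K. ereal (cmod (poly_eval p z)) * exp_ext (- (ereal (real (total_deg p)) * Q z)))"

definition weighted_extremal ::
    "(complex ^ 'n::finite) set \<Rightarrow> (complex ^ 'n \<Rightarrow> ereal) \<Rightarrow> complex ^ 'n \<Rightarrow> ereal" where
  "weighted_extremal K Q z =
     (SUP p\<in>{p. total_deg p > 0 \<and> weighted_norm K Q p \<le> 1}.
        ereal (1 / real (total_deg p)) * log_ext (cmod (poly_eval p z)))"

text \<open>\<open>z\<^sup>2 = z\<^sub>1\<^sup>2 + \<dots> + z\<^sub>n\<^sup>2\<close>, bilinear (no conjugation) also for complex vectors.\<close>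

definition vec_sq :: "'a::comm_ring_1 ^ 'n::finite \<Rightarrow> 'a" where
  "vec_sq z = (\<Sum>i\<in>UNIV. (z $ i)\<^sup>2)"

definition cvec :: "real ^ 'n \<Rightarrow> complex ^ 'n" where
  "cvec x = (\<chi> i. complex_of_real (x $ i))"

end

theory Submission
  imports Defs "HOL-Complex_Analysis.Conformal_Mappings"
begin

text \<open>
  The formula becomes transparent after homogenizing. A polynomial \<open>p\<close> of degree \<open>d\<close> on \<open>\<complex>\<^sup>n\<close>
  corresponds to a form \<open>P\<close> of degree \<open>d\<close> on \<open>\<complex> \<times> \<complex>\<^sup>n\<close> with \<open>P (1, z) = p z\<close>, and since
  \<open>e\<^sup>-\<^sup>d\<^sup>Q\<close> is the \<open>d\<close>-th power of \<open>1 / \<bar>(1, x)\<bar>\<close>, the constraint on \<open>p\<close> says exactly that \<open>\<bar>P\<bar>\<close> is at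
  most \<open>1\<close> on the real unit sphere of \<open>\<real> \<times> \<real>\<^sup>n\<close>. So the question is how large such a form can be at
  the complex point \<open>Z = (1, z)\<close>. The answer is the \<open>d\<close>-th power of the Lie norm of \<open>Z\<close>, and the
  formula of the theorem is the logarithm of that norm.

  Multiplying \<open>Z\<close> by a complex number of modulus one changes neither \<open>\<bar>P Z\<bar>\<close> nor the claimed value,
  and a suitable rotation turns \<open>Z\<close> into \<open>X + \<i> Y\<close> with real \<open>X \<bottom> Y\<close> of lengths \<open>a \<ge> b\<close>
  (lemma \<open>orthogonal_form\<close>). Then \<open>1 + \<bar>z\<bar>\<^sup>2 = a\<^sup>2 + b\<^sup>2\<close> and \<open>\<bar>1 + z\<^sup>2\<bar> = a\<^sup>2 - b\<^sup>2\<close>, so the claimed value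
  of the extremal function is just \<open>ln (a + b)\<close>.

  For the upper bound (lemma \<open>homogenization_bound\<close>) only the plane spanned by the directions \<open>e\<close>, \<open>f\<close>
  of \<open>X\<close>, \<open>Y\<close> matters. Its real unit circle, up to unimodular factors, is the image of the circle
  \<open>\<bar>u\<bar> = 1\<close> under an affine map of \<open>u\<close>, while the rotated \<open>Z\<close> is \<open>a + b\<close> times the image of a point of
  \<open>[0, 1]\<close>; the maximum principle on the unit disc gives \<open>\<bar>P Z\<bar> \<le> (a + b)\<^sup>d\<close>.

  For the lower bound (lemma \<open>extremal_affine\<close>) degree one already suffices: pairing bilinearly with
  \<open>e - \<i> f\<close> is bounded by \<open>1\<close> on the real sphere by Bessel's inequality, and takes the value \<open>a + b\<close>
  at \<open>a e + \<i> b f\<close>. The supremum is therefore attained at every point.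
\<close>

section \<open>Complex combinations of real vectors\<close>

text \<open>Real vectors in \<open>\<real> \<times> \<real>\<^sup>n\<close> and complex ones in \<open>\<complex> \<times> \<complex>\<^sup>n\<close> are kept apart, so that
  orthogonality and norms of the former are the library's; the first factor carries the homogenizing
  coordinate.\<close>

definition complex_comb :: "complex \<Rightarrow> complex \<Rightarrow> real \<times> (real ^ 'n) \<Rightarrow> real \<times> (real ^ 'n) \<Rightarrow> complex \<times> (complex ^ 'n)" where
  "complex_comb \<alpha> \<beta> v w = (\<alpha> * of_real (fst v) + \<beta> * of_real (fst w),
                 \<chi> i. \<alpha> * of_real (snd v $ i) + \<beta> * of_real (snd w $ i))"

definition complexify :: "real \<times> (real ^ 'n) \<Rightarrow> complex \<times> (complex ^ 'n)" where
  "complexify v = (of_real (fst v), cvec (snd v))"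

definition cscale :: "complex \<Rightarrow> complex \<times> (complex ^ 'n) \<Rightarrow> complex \<times> (complex ^ 'n)" where
  "cscale c Z = (c * fst Z, c *s snd Z)"

lemma cscale_complex_comb: "cscale c (complex_comb \<alpha> \<beta> v w) = complex_comb (c * \<alpha>) (c * \<beta>) v w"
  by (simp add: cscale_def complex_comb_def vec_eq_iff algebra_simps)

lemma complex_comb_scaleR:
  "complex_comb \<alpha> \<beta> (r *\<^sub>R v) (s *\<^sub>R w) = complex_comb (\<alpha> * of_real r) (\<beta> * of_real s) v w"
  by (simp add: complex_comb_def vec_eq_iff)

lemma complex_comb_of_real: "complex_comb (of_real r) (of_real s) v w = complexify (r *\<^sub>R v + s *\<^sub>R w)"
  by (simp add: complex_comb_def complexify_def cvec_def vec_eq_iff)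

lemma cvec_nth [simp]: "cvec x $ i = of_real (x $ i)"
  by (simp add: cvec_def)

lemma vec_sq_real: "vec_sq x = (norm x)\<^sup>2" for x :: "real ^ 'n::finite"
  by (simp add: vec_sq_def norm_vec_def L2_set_def sum_nonneg)

lemma vec_sq_cvec: "vec_sq (cvec x) = of_real ((norm x)\<^sup>2)" for x :: "real ^ 'n::finite"
  by (simp add: vec_sq_def flip: vec_sq_real)

lemma norm_vec_sq: "(norm z)\<^sup>2 = (\<Sum>i\<in>UNIV. (cmod (z $ i))\<^sup>2)" for z :: "complex ^ 'n::finite"
  by (simp add: norm_vec_def L2_set_def sum_nonneg)

lemma norm_pair_sq: "(norm v)\<^sup>2 = (fst v)\<^sup>2 + (norm (snd v))\<^sup>2" for v :: "real \<times> (real ^ 'n::finite)"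
  by (cases v) (simp add: norm_Pair)

text \<open>The rotation \<open>c\<close> is chosen so that the bilinear square of \<open>c Z\<close> is a non-negative real. With
  \<open>c Z = X + \<i> Y\<close> that square is \<open>\<bar>X\<bar>\<^sup>2 - \<bar>Y\<bar>\<^sup>2 + 2 \<i> (X \<bullet> Y)\<close>, so its imaginary part gives orthogonality
  and its real part the comparison of the lengths.\<close>

lemma orthogonal_form:
  fixes \<zeta> :: complex and z :: "complex ^ 'n::finite"
  obtains c and X Y :: "real \<times> (real ^ 'n)"
    where "cmod c = 1" "cscale c (\<zeta>, z) = complex_comb 1 \<i> X Y" "inner X Y = 0" "norm Y \<le> norm X"
      "(norm X)\<^sup>2 + (norm Y)\<^sup>2 = (cmod \<zeta>)\<^sup>2 + (norm z)\<^sup>2"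
      "(norm X)\<^sup>2 - (norm Y)\<^sup>2 = cmod (\<zeta>\<^sup>2 + vec_sq z)"
proof -
  define s where "s = \<zeta>\<^sup>2 + vec_sq z"
  define c where "c = cis (- Arg s / 2)"
  have c2: "c\<^sup>2 * s = of_real (cmod s)"
  proof -
    have "c\<^sup>2 * s = cis (- Arg s) * (of_real (cmod s) * cis (Arg s))"
      using rcis_cmod_Arg[of s] by (simp add: c_def power2_eq_square cis_mult rcis_def)
    also have "\<dots> = of_real (cmod s) * (cis (- Arg s) * cis (Arg s))"
      by (rule mult.left_commute)
    finally show ?thesis by (simp add: cis_mult)
  qed
  have c1: "cmod c = 1" by (simp add: c_def)
  define X :: "real \<times> (real ^ 'n)" where "X = (Re (c * \<zeta>), \<chi> i. Re (c * z $ i))"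
  define Y :: "real \<times> (real ^ 'n)" where "Y = (Im (c * \<zeta>), \<chi> i. Im (c * z $ i))"
  have comb: "cscale c (\<zeta>, z) = complex_comb 1 \<i> X Y"
    unfolding cscale_def complex_comb_def X_def Y_def
    by (simp add: vec_eq_iff complex_eq_iff)
  have nX: "(norm X)\<^sup>2 = (Re (c * \<zeta>))\<^sup>2 + (\<Sum>i\<in>UNIV. (Re (c * z $ i))\<^sup>2)"
    unfolding norm_pair_sq by (simp add: X_def flip: vec_sq_real) (simp add: vec_sq_def)
  have nY: "(norm Y)\<^sup>2 = (Im (c * \<zeta>))\<^sup>2 + (\<Sum>i\<in>UNIV. (Im (c * z $ i))\<^sup>2)"
    unfolding norm_pair_sq by (simp add: Y_def flip: vec_sq_real) (simp add: vec_sq_def)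
  have XY: "inner X Y = Re (c * \<zeta>) * Im (c * \<zeta>) + (\<Sum>i\<in>UNIV. Re (c * z $ i) * Im (c * z $ i))"
    by (simp add: X_def Y_def inner_vec_def)
  have sq: "of_real (cmod s) = (c * \<zeta>)\<^sup>2 + (\<Sum>i\<in>UNIV. (c * z $ i)\<^sup>2)"
    unfolding c2[symmetric] by (simp add: s_def vec_sq_def power_mult_distrib distrib_left sum_distrib_left)
  have Re2: "Re (x\<^sup>2) = (Re x)\<^sup>2 - (Im x)\<^sup>2" and Im2: "Im (x\<^sup>2) = 2 * (Re x * Im x)" for x
    by (simp_all add: power2_eq_square)
  have diff: "(norm X)\<^sup>2 - (norm Y)\<^sup>2 = cmod s"
    using arg_cong[OF sq, of Re] unfolding nX nY
    by (simp only: plus_complex.sel Re_sum Re2 sum_subtractf Re_complex_of_real)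
  have "2 * inner X Y = 0"
    using arg_cong[OF sq, of Im] unfolding XY
    by (simp only: plus_complex.sel Im_sum Im2 Im_complex_of_real distrib_left sum_distrib_left)
  then have orth: "inner X Y = 0" by simp
  have "(norm X)\<^sup>2 + (norm Y)\<^sup>2 = (cmod (c * \<zeta>))\<^sup>2 + (\<Sum>i\<in>UNIV. (cmod (c * z $ i))\<^sup>2)"
    unfolding nX nY cmod_power2 sum.distrib by linarith
  also have "\<dots> = (cmod \<zeta>)\<^sup>2 + (norm z)\<^sup>2"
    by (simp only: norm_mult c1 mult_1 norm_vec_sq)
  finally have sum: "(norm X)\<^sup>2 + (norm Y)\<^sup>2 = (cmod \<zeta>)\<^sup>2 + (norm z)\<^sup>2" .
  have "(norm Y)\<^sup>2 \<le> (norm X)\<^sup>2"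
    using diff norm_ge_zero[of s] by linarith
  then have "norm Y \<le> norm X"
    by (rule power2_le_imp_le) simp
  from that[OF c1 comb orth this sum diff[unfolded s_def]] show ?thesis .
qed

text \<open>When \<open>Y = 0\<close> the direction \<open>f\<close> is not determined by \<open>Y\<close>; the dimension hypothesis leaves room
  for some unit vector orthogonal to \<open>X\<close>.\<close>

lemma orthonormal_pair:
  fixes X Y :: "'a::euclidean_space"
  assumes "2 \<le> DIM('a)" "inner X Y = 0" "X \<noteq> 0"
  obtains e f where "norm e = 1" "norm f = 1" "inner e f = 0" "X = norm X *\<^sub>R e" "Y = norm Y *\<^sub>R f"
proof -
  obtain W where W: "W \<noteq> 0" "inner X W = 0" "Y = norm Y *\<^sub>R (W /\<^sub>R norm W)"
  proof (cases "Y = 0")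
    case True
    obtain W where "W \<noteq> 0" "orthogonal X W"
      using orthogonal_to_vector_exists[OF assms(1)] by blast
    with True that show ?thesis by (auto simp: orthogonal_def)
  next
    case False
    with that[of Y] assms(2) show ?thesis by simp
  qed
  show ?thesis
    using that[of "X /\<^sub>R norm X" "W /\<^sub>R norm W"] W assms(3) by simp
qed

text \<open>Bessel's inequality: what remains of \<open>v\<close> after removing its projections has non-negative
  length.\<close>

lemma bessel_pair:
  fixes e f v :: "'a::real_inner"
  assumes "norm e = 1" "norm f = 1" "inner e f = 0"
  shows "(inner e v)\<^sup>2 + (inner f v)\<^sup>2 \<le> (norm v)\<^sup>2"
proof -
  have ef: "inner e e = 1" "inner f f = 1" "inner f e = 0"
    using assms by (auto simp: norm_eq_1 inner_commute)
  have "0 \<le> inner (v - inner e v *\<^sub>R e - inner f v *\<^sub>R f) (v - inner e v *\<^sub>R e - inner f v *\<^sub>R f)"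
    by simp
  also have "\<dots> = inner v v - (inner e v)\<^sup>2 - (inner f v)\<^sup>2"
    by (simp add: inner_diff_left inner_diff_right ef assms(3) inner_commute[of v e]
        inner_commute[of v f] power2_eq_square)
  finally show ?thesis by (simp add: power2_norm_eq_inner)
qed

section \<open>Homogenization\<close>

definition monom_deg :: "('n::finite \<Rightarrow>\<^sub>0 nat) \<Rightarrow> nat" where
  "monom_deg m = (\<Sum>i\<in>UNIV. Poly_Mapping.lookup m i)"

definition homogenization :: "'n::finite cpoly \<Rightarrow> complex \<times> (complex ^ 'n) \<Rightarrow> complex" where
  "homogenization p Z = (\<Sum>m\<in>Poly_Mapping.keys p. Poly_Mapping.lookup p m *
      (fst Z ^ (total_deg p - monom_deg m) * (\<Prod>i\<in>UNIV. (snd Z $ i) ^ Poly_Mapping.lookup m i)))"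

lemma homogenization_one: "homogenization p (1, z) = poly_eval p z"
  by (simp add: homogenization_def poly_eval_def)

lemma monom_deg_zero: "monom_deg 0 = 0"
  by (simp add: monom_deg_def)

lemma total_deg_eq: "total_deg p = Max (insert 0 (monom_deg ` Poly_Mapping.keys p))"
  unfolding total_deg_def monom_deg_def ..

lemma monom_deg_le_total_deg: "m \<in> Poly_Mapping.keys p \<Longrightarrow> monom_deg m \<le> total_deg p"
  unfolding total_deg_eq by (intro Max_ge) auto

lemma homogenization_cscale: "homogenization p (cscale c Z) = c ^ total_deg p * homogenization p Z"
proof -
  have *: "(c * fst Z) ^ (total_deg p - monom_deg m) * (\<Prod>i\<in>UNIV. (c * snd Z $ i) ^ Poly_Mapping.lookup m i) =
      c ^ total_deg p * (fst Z ^ (total_deg p - monom_deg m) * (\<Prod>i\<in>UNIV. (snd Z $ i) ^ Poly_Mapping.lookup m i))"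
    if "m \<in> Poly_Mapping.keys p" for m
  proof -
    have "c ^ total_deg p = c ^ (total_deg p - monom_deg m) * c ^ monom_deg m"
      using monom_deg_le_total_deg[OF that] by (simp flip: power_add)
    then show ?thesis
      by (simp add: power_mult_distrib prod.distrib monom_deg_def flip: power_sum)
  qed
  show ?thesis
    unfolding homogenization_def sum_distrib_left by (intro sum.cong refl) (simp add: cscale_def *)
qed

text \<open>Off the hyperplane at infinity \<open>t = 0\<close> the bound is the hypothesis rescaled by homogeneity;
  on that hyperplane it follows by letting \<open>t\<close> tend to \<open>0\<close>.\<close>

lemma homogenization_real_bound:
  assumes bound: "\<And>x. cmod (poly_eval p (cvec x)) \<le> sqrt (1 + (norm x)\<^sup>2) ^ total_deg p"
  shows "cmod (homogenization p (complexify v)) \<le> norm v ^ total_deg p"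
proof -
  define x where "x = snd v"
  have *: "cmod (homogenization p (complexify (t, x))) \<le> norm (t, x) ^ total_deg p" if "t \<noteq> 0" for t
  proof -
    have "complexify (t, x) = cscale (of_real t) (1, cvec (x /\<^sub>R t))"
      using that by (simp add: complexify_def cscale_def vec_eq_iff)
    then have "cmod (homogenization p (complexify (t, x))) =
        \<bar>t\<bar> ^ total_deg p * cmod (poly_eval p (cvec (x /\<^sub>R t)))"
      by (simp add: homogenization_cscale homogenization_one norm_mult norm_power)
    also have "\<dots> \<le> \<bar>t\<bar> ^ total_deg p * sqrt (1 + (norm (x /\<^sub>R t))\<^sup>2) ^ total_deg p"
      by (intro mult_left_mono bound) simp
    also have "\<dots> = norm (t, x) ^ total_deg p"
    proof -
      have "\<bar>t\<bar> * sqrt (1 + (norm (x /\<^sub>R t))\<^sup>2) = sqrt (t\<^sup>2 * (1 + (norm (x /\<^sub>R t))\<^sup>2))"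
        by (simp add: real_sqrt_mult)
      also have "t\<^sup>2 * (1 + (norm (x /\<^sub>R t))\<^sup>2) = t\<^sup>2 + (norm x)\<^sup>2"
        using that by (simp add: power_mult_distrib field_simps)
      finally show ?thesis by (simp add: norm_Pair flip: power_mult_distrib)
    qed
    finally show ?thesis .
  qed
  have "((\<lambda>t. cmod (homogenization p (complexify (t, x)))) \<longlongrightarrow> cmod (homogenization p (complexify (fst v, x)))) (at (fst v))"
    unfolding homogenization_def complexify_def by (auto intro!: tendsto_intros)
  moreover have "((\<lambda>t. norm (t, x) ^ total_deg p) \<longlongrightarrow> norm (fst v, x) ^ total_deg p) (at (fst v))"
    by (intro tendsto_intros)
  moreover have "eventually (\<lambda>t::real. t \<noteq> 0) (at (fst v))"
    by (rule eventually_neq_at_within)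
  then have "eventually (\<lambda>t. cmod (homogenization p (complexify (t, x))) \<le> norm (t, x) ^ total_deg p) (at (fst v))"
    by eventually_elim (rule *)
  ultimately have "cmod (homogenization p (complexify (fst v, x))) \<le> norm (fst v, x) ^ total_deg p"
    by (intro tendsto_le[of "at (fst v)"]) auto
  then show ?thesis by (simp add: x_def)
qed

section \<open>The upper bound\<close>

text \<open>The affine map \<open>L u = ((u + 1) / 2) e + ((u - 1) / (2 \<i>)) f\<close> is the holomorphic continuation
  of the real unit circle: \<open>L (w\<^sup>2) = w (Re w e + Im w f)\<close> for \<open>\<bar>w\<bar> = 1\<close>. Hence the form, composed with
  \<open>L\<close>, is a polynomial in \<open>u\<close> bounded by \<open>1\<close> on the unit circle, and so on the disc. Using \<open>w\<^sup>2\<close> rather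
  than \<open>w\<close> as the variable avoids negative powers and covers the degenerate case \<open>a = b\<close>, where
  \<open>u = 0\<close>.\<close>

lemma homogenization_bound:
  fixes p :: "'n::finite cpoly"
  assumes bound: "\<And>v. cmod (homogenization p (complexify v)) \<le> norm v ^ total_deg p"
    and ef: "norm e = 1" "norm f = 1" "inner e f = 0"
    and ab: "0 \<le> b" "b \<le> a" "0 < a"
  shows "cmod (homogenization p (complex_comb (of_real a) (\<i> * of_real b) e f)) \<le> (a + b) ^ total_deg p"
proof -
  define L where "L u = complex_comb ((u + 1) / 2) ((u - 1) / (2 * \<i>)) e f" for u
  \<comment> \<open>Solving \<open>(a + b) L u = a e + \<i> b f\<close> for \<open>u\<close>; it lies in the disc because \<open>b \<ge> 0\<close> and \<open>a \<ge> 0\<close>.\<close>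
  define u0 :: complex where "u0 = of_real ((a - b) / (a + b))"
  have hol: "(\<lambda>u. homogenization p (L u)) holomorphic_on S" for S
    unfolding homogenization_def L_def complex_comb_def by (auto intro!: holomorphic_intros)
  have circle: "cmod (homogenization p (L u)) \<le> 1" if "cmod u = 1" for u
  proof -
    define w where "w = cis (Arg u / 2)"
    have w: "u = w\<^sup>2" "cmod w = 1"
      using that rcis_cmod_Arg[of u] by (simp_all add: w_def power2_eq_square cis_mult rcis_def)
    have ww: "w * cnj w = 1"
      using w(2) by (simp add: complex_norm_square[symmetric])
    have "u + 1 = w * (w + cnj w)" "u - 1 = w * (w - cnj w)"
      using ww by (simp_all add: w(1) power2_eq_square algebra_simps)
    then have "u + 1 = 2 * (w * of_real (Re w))" "u - 1 = (2 * \<i>) * (w * of_real (Im w))"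
      unfolding complex_add_cnj complex_diff_cnj by simp_all
    moreover have two_i: "2 * \<i> \<noteq> 0" by simp
    ultimately have "(u + 1) / 2 = w * of_real (Re w)" "(u - 1) / (2 * \<i>) = w * of_real (Im w)"
      by (simp, simp only: nonzero_mult_div_cancel_left[OF two_i])
    then have "L u = cscale w (complexify (Re w *\<^sub>R e + Im w *\<^sub>R f))"
      by (simp add: L_def cscale_complex_comb flip: complex_comb_of_real)
    moreover have "norm (Re w *\<^sub>R e + Im w *\<^sub>R f) = 1"
    proof -
      have "(Re w)\<^sup>2 + (Im w)\<^sup>2 = 1" using w(2) by (metis cmod_power2 one_power2)
      then show ?thesis
        using ef by (simp add: norm_eq_1 inner_add_left inner_add_right inner_commute[of f e] power2_eq_square)
    qed
    ultimately show ?thesis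
      using bound[of "Re w *\<^sub>R e + Im w *\<^sub>R f"] w(2) by (simp add: homogenization_cscale norm_mult norm_power)
  qed
  have "\<bar>(a - b) / (a + b)\<bar> \<le> 1"
    using ab by simp
  then have u0: "u0 \<in> cball 0 1"
    unfolding u0_def mem_cball_0 norm_of_real .
  have "cmod (homogenization p (L u0)) \<le> 1"
  proof (rule maximum_modulus_frontier[of "\<lambda>u. homogenization p (L u)" "cball 0 1"])
    show "(\<lambda>u. homogenization p (L u)) holomorphic_on interior (cball 0 1)"
      by (rule hol)
    show "continuous_on (closure (cball 0 1)) (\<lambda>u. homogenization p (L u))"
      by (rule holomorphic_on_imp_continuous_on[OF hol])
    show "cmod (homogenization p (L u)) \<le> 1" if "u \<in> frontier (cball 0 1)" for u
      using that by (intro circle) (simp add: frontier_cball)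
  qed (use u0 in simp_all)
  moreover have "complex_comb (of_real a) (\<i> * of_real b) e f = cscale (of_real (a + b)) (L u0)"
  proof -
    have "(a + b) * ((a - b) / (a + b)) = a - b"
      using ab by simp
    then have "of_real (a + b) * u0 = of_real (a - b)"
      unfolding u0_def of_real_mult[symmetric] by (rule arg_cong)
    then have "of_real (a + b) * (u0 + 1) = 2 * of_real a"
      "of_real (a + b) * (u0 - 1) = - 2 * of_real b"
      by (simp_all add: distrib_left right_diff_distrib)
    then have "of_real (a + b) * ((u0 + 1) / 2) = of_real a"
      "of_real (a + b) * ((u0 - 1) / (2 * \<i>)) = \<i> * of_real b"
      unfolding times_divide_eq_right by simp_all
    then show ?thesis by (simp only: L_def cscale_complex_comb)
  qed
  moreover have "cmod (of_real (a + b)) = a + b"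
    using ab by (simp only: norm_of_real)
  ultimately show ?thesis
    using ab by (simp only: homogenization_cscale norm_mult norm_power) (simp add: mult_left_le)
qed

section \<open>Affine polynomials\<close>

definition affine_cpoly :: "complex \<Rightarrow> complex ^ 'n \<Rightarrow> 'n::finite cpoly" where
  "affine_cpoly c0 c = Poly_Mapping.single 0 c0 +
     (\<Sum>i\<in>UNIV. Poly_Mapping.single (Poly_Mapping.single i (Suc 0)) (c $ i))"

lemma single_one_eq_iff [simp]:
  "Poly_Mapping.single i (Suc 0) = Poly_Mapping.single j (Suc 0) \<longleftrightarrow> i = j"
  by (metis lookup_single_eq lookup_single_not_eq Zero_not_Suc)

lemma single_one_neq_zero [simp]: "Poly_Mapping.single i (Suc 0) \<noteq> 0"
  by (metis lookup_single_eq lookup_zero Zero_not_Suc)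

lemma lookup_affine_cpoly:
  "Poly_Mapping.lookup (affine_cpoly c0 c) m =
     (c0 when 0 = m) + (\<Sum>i\<in>UNIV. c $ i when Poly_Mapping.single i (Suc 0) = m)"
  by (simp add: affine_cpoly_def lookup_add lookup_sum lookup_single)

lemma lookup_affine_cpoly_0: "Poly_Mapping.lookup (affine_cpoly c0 c) 0 = c0"
  by (simp add: lookup_affine_cpoly when_def)

lemma lookup_affine_cpoly_single:
  "Poly_Mapping.lookup (affine_cpoly c0 c) (Poly_Mapping.single i (Suc 0)) = c $ i"
  by (simp add: lookup_affine_cpoly when_def single_one_neq_zero[symmetric])

lemma keys_affine_cpoly:
  "Poly_Mapping.keys (affine_cpoly c0 c) \<subseteq> insert 0 (range (\<lambda>i. Poly_Mapping.single i (Suc 0)))"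
proof
  fix m assume "m \<in> Poly_Mapping.keys (affine_cpoly c0 c)"
  then have "Poly_Mapping.lookup (affine_cpoly c0 c) m \<noteq> 0" by (simp add: in_keys_iff)
  then show "m \<in> insert 0 (range (\<lambda>i. Poly_Mapping.single i (Suc 0)))"
    by (rule contrapos_np) (auto simp: lookup_affine_cpoly when_def intro!: sum.neutral)
qed

lemma poly_eval_affine_cpoly: "poly_eval (affine_cpoly c0 c) z = c0 + (\<Sum>i\<in>UNIV. c $ i * z $ i)"
proof -
  let ?S = "range (\<lambda>i. Poly_Mapping.single i (Suc 0))"
  let ?t = "\<lambda>m. Poly_Mapping.lookup (affine_cpoly c0 c) m * (\<Prod>i\<in>UNIV. (z $ i) ^ Poly_Mapping.lookup m i)"
  have mono: "(\<Prod>j\<in>UNIV. (z $ j) ^ Poly_Mapping.lookup (Poly_Mapping.single i (Suc 0)) j) = z $ i" for i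
  proof -
    have "(z $ j) ^ Poly_Mapping.lookup (Poly_Mapping.single i (Suc 0)) j = (if j = i then z $ j else 1)" for j
      by (auto simp: lookup_single when_def)
    then show ?thesis by simp
  qed
  have "poly_eval (affine_cpoly c0 c) z = (\<Sum>m\<in>insert 0 ?S. ?t m)"
    unfolding poly_eval_def
    by (rule sum.mono_neutral_left) (use keys_affine_cpoly in \<open>auto simp: in_keys_iff\<close>)
  also have "\<dots> = ?t 0 + (\<Sum>m\<in>?S. ?t m)"
    by (rule sum.insert) (auto simp: single_one_neq_zero[symmetric])
  also have "(\<Sum>m\<in>?S. ?t m) = (\<Sum>i\<in>UNIV. ?t (Poly_Mapping.single i (Suc 0)))"
    by (subst sum.reindex) (auto simp: inj_on_def)
  finally show ?thesis
    by (simp only: mono lookup_affine_cpoly_0 lookup_affine_cpoly_single) simp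
qed

lemma total_deg_affine_cpoly:
  assumes "c \<noteq> 0"
  shows "total_deg (affine_cpoly c0 c) = 1"
proof -
  obtain i where i: "c $ i \<noteq> 0" using assms by (auto simp: vec_eq_iff)
  have single: "monom_deg (Poly_Mapping.single j (Suc 0)) = 1" for j :: 'a
    by (simp add: monom_deg_def lookup_single when_def)
  have keys: "monom_deg ` Poly_Mapping.keys (affine_cpoly c0 c) \<subseteq> {0, 1}"
    using image_mono[OF keys_affine_cpoly, of monom_deg c0 c]
    by (simp add: image_image single monom_deg_zero)
  have "total_deg (affine_cpoly c0 c) \<le> 1"
    unfolding total_deg_eq
  proof (intro Max.boundedI)
    fix a assume "a \<in> insert 0 (monom_deg ` Poly_Mapping.keys (affine_cpoly c0 c))"
    then show "a \<le> 1"
      using keys by auto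
  qed auto
  moreover have "Poly_Mapping.single i (Suc 0) \<in> Poly_Mapping.keys (affine_cpoly c0 c)"
    using i by (simp only: in_keys_iff lookup_affine_cpoly_single) simp
  from monom_deg_le_total_deg[OF this] have "1 \<le> total_deg (affine_cpoly c0 c)"
    by (simp only: single)
  ultimately show ?thesis by simp
qed

text \<open>The polynomial is \<open>x \<mapsto> (e - \<i> f) \<cdot> (1, x)\<close>. It is not constant: otherwise both \<open>e\<close> and \<open>f\<close> would
  lie on the axis of the homogenizing coordinate, and orthonormal vectors cannot.\<close>

lemma extremal_affine:
  fixes e f :: "real \<times> (real ^ 'n::finite)"
  assumes ef: "norm e = 1" "norm f = 1" "inner e f = 0"
    and c: "cmod c = 1" and z: "cscale c (1, z) = complex_comb (of_real a) (\<i> * of_real b) e f"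
    and ab: "0 \<le> a" "0 \<le> b"
  obtains p :: "'n cpoly" where "total_deg p = 1"
    "\<And>x. cmod (poly_eval p (cvec x)) \<le> sqrt (1 + (norm x)\<^sup>2)"
    "cmod (poly_eval p z) = a + b"
proof -
  define g where "g = (\<chi> i. Complex (snd e $ i) (- snd f $ i))"
  define p where "p = affine_cpoly (Complex (fst e) (- fst f)) g"
  have g: "g \<noteq> 0"
  proof
    assume "g = 0"
    then have "snd e = 0" "snd f = 0"
      by (simp_all add: g_def vec_eq_iff complex_eq_iff)
    then show False
      using ef by (cases e; cases f) (auto simp: norm_Pair)
  qed
  have "cmod (poly_eval p (cvec x)) \<le> sqrt (1 + (norm x)\<^sup>2)" for x
  proof -
    have "poly_eval p (cvec x) = Complex (inner e (1, x)) (- inner f (1, x))"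
      by (cases e; cases f) (simp add: p_def poly_eval_affine_cpoly g_def complex_eq_iff inner_vec_def sum_negf)
    then have "cmod (poly_eval p (cvec x)) = sqrt ((inner e (1, x))\<^sup>2 + (inner f (1, x))\<^sup>2)"
      by (simp add: cmod_def)
    also have "\<dots> \<le> sqrt (1 + (norm x)\<^sup>2)"
      using bessel_pair[OF ef, of "(1, x)"] by (simp add: norm_Pair)
    finally show ?thesis .
  qed
  moreover have "cmod (poly_eval p z) = a + b"
  proof -
    define B :: "complex \<times> (complex ^ 'n) \<Rightarrow> complex"
      where "B Z = Complex (fst e) (- fst f) * fst Z + (\<Sum>i\<in>UNIV. g $ i * snd Z $ i)" for Z
    have inners: "fst e * fst e + (\<Sum>i\<in>UNIV. snd e $ i * snd e $ i) = 1"
      "fst f * fst f + (\<Sum>i\<in>UNIV. snd f $ i * snd f $ i) = 1"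
      "fst e * fst f + (\<Sum>i\<in>UNIV. snd e $ i * snd f $ i) = 0"
      using ef by (simp_all add: norm_eq_1 inner_prod_def inner_vec_def)
    \<comment> \<open>\<open>(e - \<i> f) \<cdot> (a e + \<i> b f) = a \<bar>e\<bar>\<^sup>2 + b \<bar>f\<bar>\<^sup>2 + \<i> (b - a) (e \<bullet> f)\<close>\<close>
    have "Re (B (complex_comb (of_real a) (\<i> * of_real b) e f)) =
        a * (fst e * fst e + (\<Sum>i\<in>UNIV. snd e $ i * snd e $ i)) +
        b * (fst f * fst f + (\<Sum>i\<in>UNIV. snd f $ i * snd f $ i))"
      by (simp add: B_def complex_comb_def g_def sum.distrib sum_distrib_left algebra_simps)
    moreover have "Im (B (complex_comb (of_real a) (\<i> * of_real b) e f)) =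
        (b - a) * (fst e * fst f + (\<Sum>i\<in>UNIV. snd e $ i * snd f $ i))"
      by (simp add: B_def complex_comb_def g_def sum.distrib sum_distrib_left sum_subtractf sum_negf algebra_simps)
    ultimately have "B (complex_comb (of_real a) (\<i> * of_real b) e f) = of_real (a + b)"
      unfolding inners by (simp add: complex_eq_iff)
    moreover have "B (cscale c (1, z)) = c * poly_eval p z"
      by (simp add: B_def cscale_def p_def poly_eval_affine_cpoly sum_distrib_left algebra_simps)
    ultimately have "cmod (c * poly_eval p z) = cmod (of_real (a + b))"
      using z by simp
    then show ?thesis
      using c ab by (simp add: norm_mult del: of_real_add)
  qed
  ultimately show ?thesis
    using that[of p] total_deg_affine_cpoly[OF g] by (simp add: p_def)
qed

section \<open>The weighted extremal function\<close>

lemma weighted_norm_le_1_iff: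
  fixes p :: "'n::finite cpoly"
  assumes "K = range (cvec :: real ^ 'n \<Rightarrow> complex ^ 'n)"
    and "\<And>x :: real ^ 'n. Q (cvec x) = ereal (1/2 * ln (1 + vec_sq x))"
  shows "weighted_norm K Q p \<le> 1 \<longleftrightarrow>
    (\<forall>x. cmod (poly_eval p (cvec x)) \<le> sqrt (1 + (norm x)\<^sup>2) ^ total_deg p)"
proof -
  have "ereal (cmod (poly_eval p (cvec x))) * exp_ext (- (ereal (real (total_deg p)) * Q (cvec x))) \<le> 1
      \<longleftrightarrow> cmod (poly_eval p (cvec x)) \<le> sqrt (1 + (norm x)\<^sup>2) ^ total_deg p" for x
  proof -
    have pos: "0 < 1 + (norm x)\<^sup>2" by (simp add: add_pos_nonneg)
    have "exp (real (total_deg p) * (1/2 * ln (1 + (norm x)\<^sup>2))) = sqrt (1 + (norm x)\<^sup>2) ^ total_deg p"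
      using pos by (simp add: exp_of_nat_mult ln_sqrt[symmetric])
    then have "exp_ext (- (ereal (real (total_deg p)) * Q (cvec x))) =
        ereal (1 / sqrt (1 + (norm x)\<^sup>2) ^ total_deg p)"
      by (simp add: exp_ext_def assms(2) vec_sq_real exp_minus inverse_eq_divide)
    then show ?thesis
      using pos by (simp add: divide_le_eq flip: one_ereal_def)
  qed
  then show ?thesis
    by (simp add: weighted_norm_def SUP_le_iff assms(1))
qed

lemma log_ext_root_le:
  assumes "0 \<le> t" "t \<le> l ^ d" "0 < l" "0 < d"
  shows "ereal (1 / real d) * log_ext t \<le> ereal (ln l)"
proof (cases "t = 0")
  case True
  with assms show ?thesis by (simp add: log_ext_def)
next
  case False
  with assms have "ln t \<le> ln (l ^ d)" by simp
  also have "\<dots> = real d * ln l" using assms by (simp add: ln_realpow)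
  finally show ?thesis
    using False assms by (simp add: log_ext_def field_simps)
qed

theorem theorem5p1:
  fixes K :: "(complex ^ 'n::finite) set" and Q :: "complex ^ 'n \<Rightarrow> ereal"
  assumes "K = range (cvec :: real ^ 'n \<Rightarrow> complex ^ 'n)"
    and "\<And>x :: real ^ 'n. Q (cvec x) = ereal (1/2 * ln (1 + vec_sq x))"
  shows "(\<forall>z\<in>K. Q z = - log_ext (cmod (1 / csqrt (1 + vec_sq z)))) \<and>
         (\<forall>z. weighted_extremal K Q z =
            ereal (1/2 * ln ((1 + (norm z)\<^sup>2) +
              sqrt ((1 + (norm z)\<^sup>2)\<^sup>2 - (cmod (1 + vec_sq z))\<^sup>2))))"
proof (intro conjI ballI allI)
  fix z assume "z \<in> K"
  then obtain x where z: "z = cvec x" using assms(1) by blast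
  have pos: "0 < 1 + (norm x)\<^sup>2" by (simp add: add_pos_nonneg)
  have "1 + vec_sq z = of_real (1 + (norm x)\<^sup>2)" by (simp add: z vec_sq_cvec)
  then have "cmod (1 / csqrt (1 + vec_sq z)) = 1 / sqrt (1 + (norm x)\<^sup>2)"
    using pos by (simp add: norm_divide del: of_real_add)
  then show "Q z = - log_ext (cmod (1 / csqrt (1 + vec_sq z)))"
    using pos by (simp add: z assms(2) vec_sq_real log_ext_def ln_div ln_sqrt)
next
  fix z :: "complex ^ 'n"
  obtain c and X Y :: "real \<times> (real ^ 'n)"
    where c: "cmod c = 1" and Z: "cscale c (1, z) = complex_comb 1 \<i> X Y" and XY: "inner X Y = 0" "norm Y \<le> norm X"
      and sum: "(norm X)\<^sup>2 + (norm Y)\<^sup>2 = 1 + (norm z)\<^sup>2"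
      and diff: "(norm X)\<^sup>2 - (norm Y)\<^sup>2 = cmod (1 + vec_sq z)"
    using orthogonal_form[of 1 z] by (metis norm_one power_one)
  have "X \<noteq> 0"
    using sum XY(2) by (auto simp: add_nonneg_eq_0_iff)
  have "2 \<le> DIM(real \<times> (real ^ 'n))" by (simp add: Suc_le_eq)
  then obtain e f where ef: "norm e = 1" "norm f = 1" "inner e f = 0"
    and X: "X = norm X *\<^sub>R e" and Y: "Y = norm Y *\<^sub>R f"
    using XY(1) \<open>X \<noteq> 0\<close> by (rule orthonormal_pair)
  define a b where "a = norm X" and "b = norm Y"
  have ab: "0 \<le> b" "b \<le> a" "0 < a"
    using XY(2) \<open>X \<noteq> 0\<close> by (simp_all add: a_def b_def)
  have Z': "cscale c (1, z) = complex_comb (of_real a) (\<i> * of_real b) e f"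
    unfolding Z by (subst X, subst Y) (simp add: complex_comb_scaleR a_def b_def)
  have "(1 + (norm z)\<^sup>2) + sqrt ((1 + (norm z)\<^sup>2)\<^sup>2 - (cmod (1 + vec_sq z))\<^sup>2) = (a + b)\<^sup>2"
  proof -
    have "(1 + (norm z)\<^sup>2)\<^sup>2 - (cmod (1 + vec_sq z))\<^sup>2 = (2 * a * b)\<^sup>2"
      unfolding sum[symmetric] diff[symmetric] a_def b_def by algebra
    then have "sqrt ((1 + (norm z)\<^sup>2)\<^sup>2 - (cmod (1 + vec_sq z))\<^sup>2) = 2 * a * b"
      using ab by simp
    then show ?thesis
      unfolding sum[symmetric] a_def b_def by algebra
  qed
  then have formula: "1/2 * ln ((1 + (norm z)\<^sup>2) +
      sqrt ((1 + (norm z)\<^sup>2)\<^sup>2 - (cmod (1 + vec_sq z))\<^sup>2)) = ln (a + b)"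
    using ab by (simp add: ln_realpow)
  show "weighted_extremal K Q z = ereal (1/2 * ln ((1 + (norm z)\<^sup>2) +
      sqrt ((1 + (norm z)\<^sup>2)\<^sup>2 - (cmod (1 + vec_sq z))\<^sup>2)))"
    unfolding formula weighted_extremal_def
  proof (rule antisym)
    show "(SUP p\<in>{p. total_deg p > 0 \<and> weighted_norm K Q p \<le> 1}.
        ereal (1 / real (total_deg p)) * log_ext (cmod (poly_eval p z))) \<le> ereal (ln (a + b))"
    proof (rule SUP_least, elim CollectE conjE)
      fix p :: "'n cpoly" assume d: "total_deg p > 0" and "weighted_norm K Q p \<le> 1"
      then have "cmod (poly_eval p (cvec x)) \<le> sqrt (1 + (norm x)\<^sup>2) ^ total_deg p" for x
        by (simp add: weighted_norm_le_1_iff[OF assms])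
      then have "cmod (homogenization p (cscale c (1, z))) \<le> (a + b) ^ total_deg p"
        unfolding Z' using ef ab by (intro homogenization_bound homogenization_real_bound)
      then have "cmod (poly_eval p z) \<le> (a + b) ^ total_deg p"
        by (simp add: homogenization_cscale homogenization_one norm_mult norm_power c)
      then show "ereal (1 / real (total_deg p)) * log_ext (cmod (poly_eval p z)) \<le> ereal (ln (a + b))"
        using d ab by (intro log_ext_root_le) auto
    qed
  next
    obtain p :: "'n cpoly" where p: "total_deg p = 1"
      "\<And>x. cmod (poly_eval p (cvec x)) \<le> sqrt (1 + (norm x)\<^sup>2)" "cmod (poly_eval p z) = a + b"
      using extremal_affine[OF ef c Z'] ab by auto
    have "weighted_norm K Q p \<le> 1"
      using p by (simp add: weighted_norm_le_1_iff[OF assms])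
    moreover have "ereal (ln (a + b)) = ereal (1 / real (total_deg p)) * log_ext (cmod (poly_eval p z))"
      using p ab by (simp add: log_ext_def)
    ultimately show "ereal (ln (a + b)) \<le> (SUP p\<in>{p. total_deg p > 0 \<and> weighted_norm K Q p \<le> 1}.
        ereal (1 / real (total_deg p)) * log_ext (cmod (poly_eval p z)))"
      using p(1) by (intro SUP_upper2[of p]) auto
  qed
qed

end
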